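(* Let $\mathcal C$ be an LDPC code with column weight $\gamma=3$ (every v-node of its Tanner graph has degree $3$) whose Tanner graph has girth $8$ and in which all cycles of length at most $12$ are chordless. Then the minimum distance of $\mathcal C$ satisfies $d_{\min}\ge 10$.
   Context: An LDPC code is the null space over $\mathbb F_2$ of a binary parity-check matrix $H$; its Tanner graph is the simple bipartite graph with variable-nodes (v-nodes, one per column of $H$) and check-nodes (c-nodes, one per row), adjacent iff the corresponding entry of $H$ is $1$. The girth is the length of a shortest cycle. $d_{\min}$ is the minimum Hamming weight of a nonzero codeword. A cycle $C$ of the Tanner graph is chordless if no c-node outside $C$ is adjacent to two distinct v-nodes of $C$ and no edge not in $C$ joins a v-node of $C$ to a c-node of $C$. *)

theory Defs
  imports "HOL-Analysis.Analysis" "HOL-Library.Z2" "HOL-Library.Extended_Nat"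
begin

(* A simple graph is given by its set of edges, each edge being a two-element set of vertices.
   A cycle is given by the list of its pairwise distinct vertices in cyclic order (so a cycle
   of the graph is represented by all rotations and reflections of such a list), and its
   length is the length of the list. *)

definition cycle_edges :: "'a list \<Rightarrow> 'a set set" where
  "cycle_edges p = {{p ! i, p ! (Suc i mod length p)} | i. i < length p}"

definition is_cycle :: "'a set set \<Rightarrow> 'a list \<Rightarrow> bool" where
  "is_cycle E p \<longleftrightarrow> 3 \<le> length p \<and> distinct p \<and> cycle_edges p \<subseteq> E"

(* The infimum is infinity for an acyclic graph. *)
definition girth :: "'a set set \<Rightarrow> enat" where
  "girth E = (INF p \<in> {p. is_cycle E p}. enat (length p))"

definition vertex_degree :: "'a set set \<Rightarrow> 'a \<Rightarrow> nat" where
  "vertex_degree E x = card {e \<in> E. x \<in> e}"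

(* For a parity-check matrix with columns indexed by 'n and rows indexed by 'm, the v-nodes are
   Inl v and the c-nodes are Inr c. *)
definition tanner_graph :: "bit ^ 'n ^ 'm \<Rightarrow> ('n + 'm) set set" where
  "tanner_graph H = {{Inl v, Inr c} | v c. H $ c $ v = 1}"

definition chordless :: "('n + 'm) set set \<Rightarrow> ('n + 'm) list \<Rightarrow> bool" where
  "chordless E p \<longleftrightarrow>
     \<not> (\<exists>c v w. Inr c \<notin> set p \<and> Inl v \<in> set p \<and> Inl w \<in> set p \<and> v \<noteq> w \<and>
          {Inl v, Inr c} \<in> E \<and> {Inl w, Inr c} \<in> E) \<and>
     \<not> (\<exists>v c. Inl v \<in> set p \<and> Inr c \<in> set p \<and>
          {Inl v, Inr c} \<in> E \<and> {Inl v, Inr c} \<notin> cycle_edges p)"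

definition ldpc_code :: "bit ^ 'n ^ 'm \<Rightarrow> (bit ^ 'n) set" where
  "ldpc_code H = {x. H *v x = 0}"

definition hamming_weight :: "bit ^ 'n \<Rightarrow> nat" where
  "hamming_weight x = card {i. x $ i \<noteq> 0}"

(* The infimum is infinity for the zero code, which has no nonzero codeword. *)
definition min_distance :: "(bit ^ 'n) set \<Rightarrow> enat" where
  "min_distance C = (INF x \<in> C - {0}. enat (hamming_weight x))"

end

theory Submission
  imports Defs
begin

text \<open>The support of a codeword, with two v-nodes adjacent when they share a c-node, is the object of
study. Every c-node meets it evenly. If some c-node met it in four v-nodes, girth 8 would force it
to have at least twelve elements; so below weight ten every c-node meets it in at most two v-nodes
and the adjacency graph is cubic and triangle-free. Its order is even by double counting, hence at
most eight. A chord of a 12-cycle of the Tanner graph corresponds to a domino (a hexagon with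
a long diagonal) of the adjacency graph, and a cubic triangle-free graph without dominoes has at
least nine vertices: ten without a quadrilateral, and otherwise by inspecting the neighbours of a
quadrilateral.\<close>

section \<open>Cubic graphs without triangles and dominoes\<close>

locale cubic_domino_free =
  fixes S :: "'a set" and E :: "'a \<Rightarrow> 'a \<Rightarrow> bool"
  assumes fin: "finite S"
    and sym: "E u v \<Longrightarrow> E v u"
    and irrefl: "\<not> E v v"
    and closed: "E u v \<Longrightarrow> v \<in> S"
    and cubic: "v \<in> S \<Longrightarrow> card {w. E v w} = 3"
    and no_triangle: "E u v \<Longrightarrow> E v w \<Longrightarrow> E w u \<Longrightarrow> False"
    and no_domino: "distinct [p, q, r, s, t, u] \<Longrightarrow> E p q \<Longrightarrow> E q r \<Longrightarrow> E r s \<Longrightarrow> E s t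
      \<Longrightarrow> E t u \<Longrightarrow> E u p \<Longrightarrow> E p s \<Longrightarrow> False"
begin

lemma third_neighbour:
  assumes "E v x" "E v y" "x \<noteq> y"
  obtains z where "z \<noteq> x" "z \<noteq> y" "{w. E v w} = {x, y, z}"
proof -
  have c: "card {w. E v w} = 3"
    using assms(1) sym closed cubic by blast
  have "card ({w. E v w} - {x, y}) = 1"
    using assms c by (subst card_Diff_subset) auto
  then obtain z where "{w. E v w} - {x, y} = {z}"
    by (auto simp: card_1_singleton_iff)
  then show thesis
    using assms that[of z] by blast
qed

lemma other_neighbours:
  assumes "E v x"
  obtains y z where "y \<noteq> x" "z \<noteq> x" "y \<noteq> z" "{w. E v w} = {x, y, z}"
proof -
  have c: "card {w. E v w} = 3"
    using assms(1) sym closed cubic by blast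
  have "card ({w. E v w} - {x}) = 2"
    using assms c by (subst card_Diff_subset) auto
  then obtain y z where "{w. E v w} - {x} = {y, z}" "y \<noteq> z"
    by (auto simp: card_2_iff)
  then show thesis
    using assms that[of y z] by blast
qed

lemma card_ge_length:
  assumes "distinct xs" "set xs \<subseteq> S"
  shows "length xs \<le> card S"
  using assms fin card_mono distinct_card by metis

text \<open>The five vertices span a copy of K_{2,3} with parts \<open>{a, c}\<close> and
  \<open>{b, d, e}\<close>. The third neighbours of \<open>b\<close>, \<open>d\<close>,
  \<open>e\<close> are new, and any two of them being equal would complete a domino, so there are
  already eight vertices.\<close>

lemma K23_bound:
  assumes E: "E a b" "E a d" "E a e" "E c b" "E c d" "E c e"
    and dist: "distinct [a, b, c, d, e]"
  shows "9 \<le> card S"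
proof (rule ccontr)
  assume "\<not> 9 \<le> card S"
  then have small: "card S \<le> 8" by simp
  note E' = E E[THEN sym]
  obtain b' where b': "b' \<noteq> a" "b' \<noteq> c" "{w. E b w} = {a, c, b'}"
    using third_neighbour[of b a c] E' dist by auto
  obtain d' where d': "d' \<noteq> a" "d' \<noteq> c" "{w. E d w} = {a, c, d'}"
    using third_neighbour[of d a c] E' dist by auto
  obtain e' where e': "e' \<noteq> a" "e' \<noteq> c" "{w. E e w} = {a, c, e'}"
    using third_neighbour[of e a c] E' dist by auto
  have Na: "E a w \<Longrightarrow> w \<in> {b, d, e}" for w
    using third_neighbour[of a b d] E dist by (metis distinct_length_2_or_more insertCI insertE
        mem_Collect_eq singletonD)
  have Nc: "E c w \<Longrightarrow> w \<in> {b, d, e}" for w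
    using third_neighbour[of c b d] E dist by (metis distinct_length_2_or_more insertCI insertE
        mem_Collect_eq singletonD)
  have adj: "E b b'" "E d d'" "E e e'" using b' d' e' by auto
  note adj' = adj adj[THEN sym]
  have out: "b' \<notin> {a, b, c, d, e}" "d' \<notin> {a, b, c, d, e}" "e' \<notin> {a, b, c, d, e}"
    using E' adj' irrefl no_triangle b' d' e' by blast+
  \<comment> \<open>A domino is two quadrilaterals sharing an edge. If \<open>b' = d'\<close>, then
    \<open>a e c d\<close> and \<open>a d b' b\<close> share the edge \<open>a d\<close>; the next
    two cases are alike.\<close>
  have "b' \<noteq> d'"
    using no_domino[of a e c d b' b] E' adj' dist out by auto
  moreover have "b' \<noteq> e'"
    using no_domino[of a d c b b' e] E' adj' dist out by auto
  moreover have "d' \<noteq> e'"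
    using no_domino[of a b c d d' e] E' adj' dist out by auto
  ultimately have dist8: "distinct [a, b, c, d, e, b', d', e']"
    using dist out by auto
  have sub: "set [a, b, c, d, e, b', d', e'] \<subseteq> S"
    using E' adj' closed by auto
  have S: "S = {a, b, c, d, e, b', d', e'}"
    using card_subset_eq[OF fin sub] card_ge_length[OF dist8 sub] distinct_card[OF dist8] small
    by simp
  txt \<open>With no ninth vertex, the neighbours of \<open>b'\<close> and \<open>d'\<close> are forced: \<open>b'\<close>, \<open>d'\<close>, \<open>e'\<close> form
    a triangle.\<close>
  have step: "E x y \<and> E x z"
    if x: "E x k" and r: "\<And>w. E x w \<Longrightarrow> w \<in> {k, y, z}" for x k y z
  proof -
    have "card {w. E x w} = 3" using x sym closed cubic by blast
    moreover have "{w. E x w} \<subseteq> {k, y, z}" using r by blast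
    moreover have "card {k, y, z} \<le> 3"
      by (simp add: card_insert_if)
    ultimately have "{w. E x w} = {k, y, z}"
      by (intro card_seteq) auto
    then show ?thesis by blast
  qed
  have "E b' d' \<and> E b' e'"
  proof (rule step[of _ b])
    fix w assume w: "E b' w"
    then have "w \<in> S" using closed by blast
    \<comment> \<open>The degrees of \<open>a\<close>, \<open>c\<close>, \<open>d\<close>,
      \<open>e\<close> are already exhausted by known neighbours, none of which is
      \<open>b'\<close>.\<close>
    moreover have "w \<noteq> a" "w \<noteq> c" using Na Nc w sym out by blast+
    moreover have "w \<noteq> d" "w \<noteq> e" using d'(3) e'(3) w[THEN sym] dist8 by auto
    moreover have "w \<noteq> b'" using w irrefl by blast
    ultimately show "w \<in> {b, d', e'}" using S by blast
  qed (use adj' in blast)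
  moreover have "E d' b' \<and> E d' e'"
  proof (rule step[of _ d])
    fix w assume w: "E d' w"
    then have "w \<in> S" using closed by blast
    moreover have "w \<noteq> a" "w \<noteq> c" using Na Nc w sym out by blast+
    moreover have "w \<noteq> b" "w \<noteq> e" using b'(3) e'(3) w[THEN sym] dist8 by auto
    moreover have "w \<noteq> d'" using w irrefl by blast
    ultimately show "w \<in> {d, b', e'}" using S by blast
  qed (use adj' in blast)
  ultimately show False using no_triangle sym by blast
qed

text \<open>If the third neighbours of two opposite corners coincide, a K_{2,3} appears. Otherwise
  \<open>a'\<close> has two neighbours besides \<open>a\<close>, and these avoid the corners as well
  as \<open>b'\<close> and \<open>d'\<close>, which gives nine vertices.\<close>

lemma quadrilateral_bound:
  assumes E: "E a b" "E b c" "E c d" "E d a" and "a \<noteq> c" "b \<noteq> d"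
  shows "9 \<le> card S"
proof -
  note E' = E E[THEN sym]
  have dist: "distinct [a, b, c, d]" using assms irrefl by auto
  obtain a' where a': "a' \<noteq> b" "a' \<noteq> d" "{w. E a w} = {b, d, a'}"
    using third_neighbour[of a b d] E' dist by auto
  obtain b' where b': "b' \<noteq> a" "b' \<noteq> c" "{w. E b w} = {a, c, b'}"
    using third_neighbour[of b a c] E' dist by auto
  obtain c' where c': "c' \<noteq> b" "c' \<noteq> d" "{w. E c w} = {b, d, c'}"
    using third_neighbour[of c b d] E' dist by auto
  obtain d' where d': "d' \<noteq> a" "d' \<noteq> c" "{w. E d w} = {a, c, d'}"
    using third_neighbour[of d a c] E' dist by auto
  have adj: "E a a'" "E b b'" "E c c'" "E d d'" using a' b' c' d' by auto
  note adj' = adj adj[THEN sym]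
  have out: "a' \<notin> {a, b, c, d}" "b' \<notin> {a, b, c, d}" "c' \<notin> {a, b, c, d}" "d' \<notin> {a, b, c, d}"
    using E' adj' irrefl no_triangle a' b' c' d' by blast+
  consider "a' = c'" | "b' = d'" | "a' \<noteq> c'" "b' \<noteq> d'" by blast
  then show ?thesis
  proof cases
    case 1
    show ?thesis by (rule K23_bound[of a b d a' c]) (use 1 E' adj' dist out in auto)
  next
    case 2
    show ?thesis by (rule K23_bound[of b a c b' d]) (use 2 E' adj' dist out in auto)
  next
    case 3
    have ne: "a' \<noteq> b'" "a' \<noteq> d'" using adj' E' no_triangle by blast+
    obtain x y where xy: "x \<noteq> a" "y \<noteq> a" "x \<noteq> y" "{w. E a' w} = {a, x, y}"
      using other_neighbours[of a' a] adj' by blast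
    \<comment> \<open>An edge \<open>a' b'\<close> would create the quadrilateral
      \<open>a a' b' b\<close>, glued to the given one along \<open>a b\<close>; similarly for
      \<open>d'\<close> along \<open>a d\<close>.\<close>
    have nb: "\<not> E a' b'" using no_domino[of a a' b' b c d] E' adj' dist out ne by auto
    have nd: "\<not> E a' d'" using no_domino[of a a' d' d c b] E' adj' dist out ne by auto
    have new: "w \<notin> {a, b, c, d, a', b', d'}" if "w \<in> {x, y}" for w
    proof -
      have w: "E a' w" "w \<noteq> a" using that xy by auto
      then have "w \<noteq> b" "w \<noteq> c" "w \<noteq> d" using b' c' d' 3 ne out sym by blast+
      then show ?thesis using w nb nd irrefl by auto
    qed
    \<comment> \<open>The vertex \<open>c'\<close> is left out of the count because it may coincide
      with \<open>x\<close> or \<open>y\<close>.\<close>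
    have "distinct [a, b, c, d, a', b', d', x, y]"
      using dist out ne 3 new xy by auto
    moreover have "set [a, b, c, d, a', b', d', x, y] \<subseteq> S"
      using E' adj' xy closed by auto
    ultimately show ?thesis using card_ge_length by fastforce
  qed
qed

text \<open>Without triangles and quadrilaterals, the ball of radius two around any vertex is a tree
  with 1 + 3 + 6 = 10 vertices.\<close>

lemma card_ge_9:
  assumes "S \<noteq> {}"
  shows "9 \<le> card S"
proof (cases "\<exists>a b c d. E a b \<and> E b c \<and> E c d \<and> E d a \<and> a \<noteq> c \<and> b \<noteq> d")
  case True
  then show ?thesis using quadrilateral_bound by blast
next
  case False
  obtain v where "v \<in> S" using assms by blast
  then obtain v1 v2 v3 where N: "{w. E v w} = {v1, v2, v3}"
    and d3: "v1 \<noteq> v2" "v2 \<noteq> v3" "v1 \<noteq> v3"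
    using cubic by (metis card_3_iff)
  then have Ev: "E v v1" "E v v2" "E v v3" by auto
  note Ev' = Ev Ev[THEN sym]
  obtain x1 y1 where 1: "x1 \<noteq> v" "y1 \<noteq> v" "x1 \<noteq> y1" "{w. E v1 w} = {v, x1, y1}"
    using other_neighbours Ev' by metis
  obtain x2 y2 where 2: "x2 \<noteq> v" "y2 \<noteq> v" "x2 \<noteq> y2" "{w. E v2 w} = {v, x2, y2}"
    using other_neighbours Ev' by metis
  obtain x3 y3 where 3: "x3 \<noteq> v" "y3 \<noteq> v" "x3 \<noteq> y3" "{w. E v3 w} = {v, x3, y3}"
    using other_neighbours Ev' by metis
  have e: "E v1 x1" "E v1 y1" "E v2 x2" "E v2 y2" "E v3 x3" "E v3 y3"
    using 1 2 3 by auto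
  \<comment> \<open>A common vertex would close the quadrilateral \<open>v p x q\<close>.\<close>
  have apart: "x \<noteq> y" if "E v p" "E v q" "p \<noteq> q" "E p x" "E q y" "x \<noteq> v" for p q x y
    using False that sym by metis
  have notN: "x \<notin> {v1, v2, v3}" if "E v p" "E p x" for p x
    using that N no_triangle sym by blast
  have "distinct [v, v1, v2, v3, x1, y1, x2, y2, x3, y3]"
    using d3 1(1-3) 2(1-3) 3(1-3) irrefl Ev
      notN[OF Ev(1) e(1)] notN[OF Ev(1) e(2)] notN[OF Ev(2) e(3)]
      notN[OF Ev(2) e(4)] notN[OF Ev(3) e(5)] notN[OF Ev(3) e(6)]
      apart[OF Ev(1,2) d3(1) e(1,3)] apart[OF Ev(1,2) d3(1) e(1,4)]
      apart[OF Ev(1,2) d3(1) e(2,3)] apart[OF Ev(1,2) d3(1) e(2,4)]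
      apart[OF Ev(2,3) d3(2) e(3,5)] apart[OF Ev(2,3) d3(2) e(3,6)]
      apart[OF Ev(2,3) d3(2) e(4,5)] apart[OF Ev(2,3) d3(2) e(4,6)]
      apart[OF Ev(1,3) d3(3) e(1,5)] apart[OF Ev(1,3) d3(3) e(1,6)]
      apart[OF Ev(1,3) d3(3) e(2,5)] apart[OF Ev(1,3) d3(3) e(2,6)]
    by auto
  moreover have "set [v, v1, v2, v3, x1, y1, x2, y2, x3, y3] \<subseteq> S"
    using Ev' e closed by auto
  ultimately show ?thesis using card_ge_length by fastforce
qed

end

section \<open>Even sets of v-nodes of degree three\<close>

text \<open>\<open>K v\<close> is the set of c-nodes adjacent to the v-node \<open>v\<close>.\<close>

locale even_v_node_set =
  fixes S :: "'v set" and K :: "'v \<Rightarrow> 'c set"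
  assumes fin: "finite S"
    and degree: "v \<in> S \<Longrightarrow> card (K v) = 3"
    and even_check: "even (card {v \<in> S. c \<in> K v})"
    and no_4_cycle: "u \<noteq> v \<Longrightarrow> c \<noteq> d \<Longrightarrow> c \<in> K u \<Longrightarrow> c \<in> K v \<Longrightarrow> d \<in> K u \<Longrightarrow> d \<in> K v \<Longrightarrow> False"
    and no_6_cycle: "distinct [u, v, w] \<Longrightarrow> distinct [c, d, e] \<Longrightarrow> c \<in> K u \<Longrightarrow> c \<in> K v
      \<Longrightarrow> d \<in> K v \<Longrightarrow> d \<in> K w \<Longrightarrow> e \<in> K w \<Longrightarrow> e \<in> K u \<Longrightarrow> False"
    and no_12_cycle_chord: "distinct [v1, v2, v3, v4, v5, v6]
      \<Longrightarrow> distinct [c, c1, c2, c3, c4, c5, c6]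
      \<Longrightarrow> c1 \<in> K v1 \<Longrightarrow> c1 \<in> K v2 \<Longrightarrow> c2 \<in> K v2 \<Longrightarrow> c2 \<in> K v3 \<Longrightarrow> c3 \<in> K v3 \<Longrightarrow> c3 \<in> K v4
      \<Longrightarrow> c4 \<in> K v4 \<Longrightarrow> c4 \<in> K v5 \<Longrightarrow> c5 \<in> K v5 \<Longrightarrow> c5 \<in> K v6 \<Longrightarrow> c6 \<in> K v6 \<Longrightarrow> c6 \<in> K v1
      \<Longrightarrow> c \<in> K v1 \<Longrightarrow> c \<in> K v4 \<Longrightarrow> False"
begin

definition V :: "'c \<Rightarrow> 'v set" where
  "V c = {v \<in> S. c \<in> K v}"

lemma finite_V: "finite (V c)"
  using fin by (simp add: V_def)

lemma finite_K: "v \<in> S \<Longrightarrow> finite (K v)"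
  using degree by (metis card.infinite zero_neq_numeral)

lemma even_card_V: "even (card (V c))"
  using even_check by (simp add: V_def)

lemma even_card: "even (card S)"
proof -
  \<comment> \<open>The type of c-nodes may be infinite here; \<open>B\<close> is the finite set of
    those that meet \<open>S\<close>.\<close>
  define B where "B = (\<Union>v\<in>S. K v)"
  have finB: "finite B" using fin finite_K by (simp add: B_def)
  have "3 * card S = (\<Sum>v\<in>S. card (K v))" using degree by simp
  also have "\<dots> = (\<Sum>v\<in>S. card {c \<in> B. c \<in> K v})"
    by (intro sum.cong refl arg_cong[of _ _ card]) (auto simp: B_def)
  also have "\<dots> = (\<Sum>v\<in>S. \<Sum>c\<in>B. if c \<in> K v then 1 else 0)"
    using finB by (simp add: sum.If_cases Int_def)
  also have "\<dots> = (\<Sum>c\<in>B. \<Sum>v\<in>S. if c \<in> K v then 1 else 0)"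
    by (rule sum.swap)
  also have "\<dots> = (\<Sum>c\<in>B. card (V c))"
    using fin by (simp add: sum.If_cases Int_def V_def)
  finally have "3 * card S = (\<Sum>c\<in>B. card (V c))" .
  moreover have "even (\<Sum>c\<in>B. card (V c))" using even_card_V by (simp add: dvd_sum)
  ultimately have "even (3 * card S)" by simp
  then show ?thesis by simp
qed

text \<open>Each v-node of a c-node \<open>c\<close> sees two further v-nodes through its other c-nodes; by girth 8 all
of these are distinct.\<close>

lemma card_V_bound: "3 * card (V c) \<le> card S"
proof -
  \<comment> \<open>An even set is not a singleton. The function \<open>g\<close> picks a second
    v-node of \<open>S\<close> at each c-node.\<close>
  have "\<exists>w. w \<in> V d \<and> w \<noteq> v" if "v \<in> V d" for v d
  proof (rule ccontr)
    assume "\<not> ?thesis"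
    then have "V d = {v}" using that by blast
    then show False using even_card_V[of d] by simp
  qed
  then obtain g where g: "\<And>v d. v \<in> V d \<Longrightarrow> g v d \<in> V d \<and> g v d \<noteq> v"
    by metis
  \<comment> \<open>\<open>A v\<close> has three elements: \<open>v\<close> and one partner through
    each of its two c-nodes other than \<open>c\<close>. These sets turn out to be disjoint for
    different \<open>v\<close> in \<open>V c\<close>.\<close>
  define A where "A v = insert v (g v ` (K v - {c}))" for v
  have mem: "v \<in> V d" if "v \<in> V c" "d \<in> K v" for v d
    using that by (simp add: V_def)
  have inK: "d \<in> K v" "v \<in> S" if "v \<in> V d" for v d
    using that by (simp_all add: V_def)
  have cardA: "card (A v) = 3" if v: "v \<in> V c" for v
  proof -
    have inj: "inj_on (g v) (K v - {c})"
      using no_4_cycle g mem[OF v] inK by (intro inj_onI) (metis DiffD1)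
    have "v \<notin> g v ` (K v - {c})" using g mem[OF v] by force
    then show ?thesis
      using inj v degree[of v] finite_K[of v] inK[OF v] by (simp add: A_def card_image)
  qed
  have sub: "A v \<subseteq> S" if v: "v \<in> V c" for v
    using g[OF mem[OF v]] inK v by (fastforce simp: A_def)
  \<comment> \<open>Here \<open>u c v d\<close> would be a 4-cycle.\<close>
  have centre: False if "u \<in> V c" "v \<in> V c" "u \<noteq> v" "d \<in> K u" "d \<noteq> c" "v = g u d" for u v d
    using that g[OF mem, of u d] no_4_cycle[of u v c d] inK by metis
  \<comment> \<open>A shared partner would close the 6-cycle
    \<open>v c u d (g u d) e\<close>.\<close>
  have outer: False if uv: "u \<in> V c" "v \<in> V c" "u \<noteq> v" and d: "d \<in> K u" "d \<noteq> c"
    and e: "e \<in> K v" "e \<noteq> c" and eq: "g u d = g v e" for u v d e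
  proof -
    have d': "g u d \<in> V d" "g u d \<noteq> u" using g mem uv d by blast+
    have e': "g u d \<in> V e" "g u d \<noteq> v" using g mem uv e eq by metis+
    have "d \<noteq> e" using no_4_cycle[of u v c d] uv d e inK by blast
    then show False
      using no_6_cycle[of v u "g u d" c d e] uv d e d' e' inK by auto
  qed
  have "A u \<inter> A v = {}" if "u \<in> V c" "v \<in> V c" "u \<noteq> v" for u v
    using that centre[of u v] centre[of v u] outer[of u v] by (fastforce simp: A_def)
  moreover have finA: "finite (A v)" if "v \<in> V c" for v
    using sub[OF that] fin by (rule finite_subset)
  ultimately have "card (\<Union>v\<in>V c. A v) = (\<Sum>v\<in>V c. card (A v))"
    using finite_V finA by (intro card_UN_disjoint) auto
  also have "\<dots> = 3 * card (V c)" using cardA by simp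
  finally show ?thesis
    using card_mono[OF fin, of "\<Union>v\<in>V c. A v"] sub by auto
qed

text \<open>Requiring \<open>V c\<close> to be the whole pair makes a c-node determine its edge, so
  distinct edges come from distinct c-nodes. Once no c-node meets \<open>S\<close> in more than two
  v-nodes, this is the same as sharing a c-node.\<close>

definition adj :: "'v \<Rightarrow> 'v \<Rightarrow> bool" where
  "adj u v \<longleftrightarrow> u \<noteq> v \<and> (\<exists>c. V c = {u, v})"

text \<open>Subdividing each edge of \<open>adj\<close> by its c-node recovers part of the Tanner
  graph: a triangle becomes a 6-cycle, and a domino a 12-cycle with an outside c-node joining two
  opposite v-nodes.\<close>

lemma cubic_domino_free_adj:
  assumes "card S < 10"
  shows "cubic_domino_free S adj"
proof
  have card2: "card (V c) = 2" if "v \<in> V c" for v c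
  proof -
    \<comment> \<open>Three times the cardinality is at most nine, so parity leaves only two for a
      nonempty \<open>V c\<close>.\<close>
    have "card (V c) < 4" using card_V_bound[of c] assms by simp
    moreover have "card (V c) \<noteq> 0" using that finite_V by auto
    ultimately have "card (V c) \<in> {1, 2, 3}" by auto
    then show ?thesis using even_card_V[of c] by auto
  qed
  have inK: "c \<in> K u" "c \<in> K v" if "V c = {u, v}" for c u v
    using that by (auto simp: V_def)
  show "finite S" by (rule fin)
  show "adj u v \<Longrightarrow> adj v u" for u v by (auto simp: adj_def insert_commute)
  show "\<not> adj v v" for v by (simp add: adj_def)
  show "adj u v \<Longrightarrow> v \<in> S" for u v by (auto simp: adj_def V_def)
  show "card {w. adj v w} = 3" if v: "v \<in> S" for v
  proof -
    \<comment> \<open>Neighbours of \<open>v\<close> and c-nodes of \<open>v\<close> are both in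
      bijection with the same set of pairs, so there are three of each.\<close>
    have "(\<lambda>w. {v, w}) ` {w. adj v w} = V ` K v"
    proof (intro equalityI subsetI)
      fix A assume "A \<in> V ` K v"
      then obtain c where c: "c \<in> K v" "A = V c" by blast
      then have "v \<in> V c" using v by (simp add: V_def)
      then obtain w where "V c = {v, w}" "w \<noteq> v"
        using card2[of v c] by (metis card_2_iff doubleton_eq_iff insertE singletonD)
      then show "A \<in> (\<lambda>w. {v, w}) ` {w. adj v w}" using c by (auto simp: adj_def)
    qed (auto simp: adj_def V_def)
    moreover have "inj_on (\<lambda>w. {v, w}) {w. adj v w}"
      by (auto simp: inj_on_def doubleton_eq_iff)
    moreover have "inj_on V (K v)"
    proof (rule inj_onI)
      fix c d assume cd: "c \<in> K v" "d \<in> K v" "V c = V d"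
      then have "v \<in> V c" using v by (simp add: V_def)
      then obtain w where "V c = {v, w}" "w \<noteq> v"
        using card2[of v c] by (metis card_2_iff doubleton_eq_iff insertE singletonD)
      then show "c = d" using no_4_cycle[of v w c d] inK cd by metis
    qed
    ultimately show ?thesis using degree[OF v] by (metis card_image)
  qed
  show False if uvw: "adj u v" "adj v w" "adj w u" for u v w
  proof -
    from uvw obtain c d e where "V c = {u, v}" "V d = {v, w}" "V e = {w, u}"
      and ne: "distinct [u, v, w]" by (auto simp: adj_def)
    moreover from this have "distinct [c, d, e]" by (auto simp: doubleton_eq_iff)
    ultimately show False using no_6_cycle[of u v w c d e] inK by blast
  qed
  show False if dist: "distinct [p, q, r, s, t, u]"
    and E: "adj p q" "adj q r" "adj r s" "adj s t" "adj t u" "adj u p" "adj p s"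
    for p q r s t u
  proof -
    from E obtain c c1 c2 c3 c4 c5 c6 where c: "V c1 = {p, q}" "V c2 = {q, r}" "V c3 = {r, s}"
      "V c4 = {s, t}" "V c5 = {t, u}" "V c6 = {u, p}" "V c = {p, s}"
      by (auto simp: adj_def)
    have "distinct (map V [c, c1, c2, c3, c4, c5, c6])"
      using dist c by (auto simp: doubleton_eq_iff)
    then have "distinct [c, c1, c2, c3, c4, c5, c6]" by (simp only: distinct_map)
    from no_12_cycle_chord[OF dist this] show False using c[THEN inK(1)] c[THEN inK(2)] by blast
  qed
qed

lemma card_ge_10:
  assumes "S \<noteq> {}"
  shows "10 \<le> card S"
proof (rule ccontr)
  assume "\<not> 10 \<le> card S"
  then have less: "card S < 10" by simp
  interpret cubic_domino_free S adj by (rule cubic_domino_free_adj[OF less])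
  from card_ge_9[OF assms] less have "card S = 9" by simp
  then show False using even_card by simp
qed

end

section \<open>Tanner graphs\<close>

lemma girth_le: "is_cycle E p \<Longrightarrow> girth E \<le> enat (length p)"
  unfolding girth_def by (rule INF_lower) simp

lemma is_cycle_iff:
  "is_cycle E p \<longleftrightarrow> 3 \<le> length p \<and> distinct p \<and>
    (\<forall>i<length p. {p ! i, p ! (Suc i mod length p)} \<in> E)"
  by (auto simp: is_cycle_def cycle_edges_def)

lemma edge_tanner_graph [simp]:
  "{Inl v, Inr c} \<in> tanner_graph H \<longleftrightarrow> H $ c $ v = 1"
  "{Inr c, Inl v} \<in> tanner_graph H \<longleftrightarrow> H $ c $ v = 1"
  by (auto simp: tanner_graph_def doubleton_eq_iff)

lemma vertex_degree_tanner_graph: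
  "vertex_degree (tanner_graph H) (Inl v) = card {c. H $ c $ v = 1}"
proof -
  have "{e \<in> tanner_graph H. Inl v \<in> e} = (\<lambda>c. {Inl v, Inr c}) ` {c. H $ c $ v = 1}"
    by (auto simp: tanner_graph_def)
  then show ?thesis
    by (simp add: vertex_degree_def card_image inj_on_def doubleton_eq_iff)
qed

lemma of_nat_bit_eq_0_iff: "(of_nat n :: bit) = 0 \<longleftrightarrow> even n"
  by (induction n) auto

text \<open>Row \<open>c\<close> of the parity-check equation, read in F_2, counts the support
  elements adjacent to \<open>c\<close> modulo two.\<close>

lemma even_card_support_check:
  fixes H :: "bit ^ 'n ^ 'm"
  assumes "H *v x = 0"
  shows "even (card {v \<in> {i. x $ i \<noteq> 0}. H $ c $ v = 1})"
proof -
  have "0 = (\<Sum>v\<in>UNIV. H $ c $ v * x $ v)"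
    using assms by (simp add: matrix_vector_mult_def vec_eq_iff)
  also have "\<dots> = (\<Sum>v\<in>UNIV. if x $ v \<noteq> 0 \<and> H $ c $ v = 1 then 1 else 0)"
    by (intro sum.cong refl) auto
  also have "\<dots> = of_nat (card {v. x $ v \<noteq> 0 \<and> H $ c $ v = 1})"
    by (simp add: sum.If_cases)
  finally show ?thesis by (simp flip: of_nat_bit_eq_0_iff)
qed

text \<open>Cycles of length 4 and 6 are shorter than the girth, and the forbidden outside c-node
  violates chordlessness of a cycle of length exactly 12.\<close>

lemma even_v_node_set_support:
  fixes H :: "bit ^ 'n ^ 'm"
  assumes deg: "\<forall>v. vertex_degree (tanner_graph H) (Inl v) = 3"
    and girth: "girth (tanner_graph H) = 8"
    and chordless: "\<forall>p. is_cycle (tanner_graph H) p \<and> length p \<le> 12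
      \<longrightarrow> chordless (tanner_graph H) p"
    and x: "H *v x = 0"
  shows "even_v_node_set {i. x $ i \<noteq> 0} (\<lambda>v. {c. H $ c $ v = 1})"
proof
  have long: "8 \<le> length p" if "is_cycle (tanner_graph H) p" for p
    using girth_le[OF that] girth by (metis enat_ord_simps(1) numeral_eq_enat)
  show "finite {i. x $ i \<noteq> 0}" by simp
  show "card {c. H $ c $ v = 1} = 3" for v
    using deg by (simp add: vertex_degree_tanner_graph)
  show "even (card {v \<in> {i. x $ i \<noteq> 0}. c \<in> {c. H $ c $ v = 1}})" for c
    using even_card_support_check[OF x] by simp
  show False if "u \<noteq> v" "c \<noteq> d" "c \<in> {c. H $ c $ u = 1}" "c \<in> {c. H $ c $ v = 1}"
    "d \<in> {c. H $ c $ u = 1}" "d \<in> {c. H $ c $ v = 1}" for u v c d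
  proof -
    have "is_cycle (tanner_graph H) [Inl u, Inr c, Inl v, Inr d]"
      using that by (auto simp: is_cycle_iff less_Suc_eq)
    from long[OF this] show False by simp
  qed
  show False if "distinct [u, v, w]" "distinct [c, d, e]"
    "c \<in> {c. H $ c $ u = 1}" "c \<in> {c. H $ c $ v = 1}"
    "d \<in> {c. H $ c $ v = 1}" "d \<in> {c. H $ c $ w = 1}"
    "e \<in> {c. H $ c $ w = 1}" "e \<in> {c. H $ c $ u = 1}" for u v w c d e
  proof -
    have "is_cycle (tanner_graph H) [Inl u, Inr c, Inl v, Inr d, Inl w, Inr e]"
      using that by (auto simp: is_cycle_iff less_Suc_eq)
    from long[OF this] show False by simp
  qed
  show False if dist: "distinct [v1, v2, v3, v4, v5, v6]" "distinct [c, c1, c2, c3, c4, c5, c6]"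
    and inc: "c1 \<in> {c. H $ c $ v1 = 1}" "c1 \<in> {c. H $ c $ v2 = 1}"
      "c2 \<in> {c. H $ c $ v2 = 1}" "c2 \<in> {c. H $ c $ v3 = 1}"
      "c3 \<in> {c. H $ c $ v3 = 1}" "c3 \<in> {c. H $ c $ v4 = 1}"
      "c4 \<in> {c. H $ c $ v4 = 1}" "c4 \<in> {c. H $ c $ v5 = 1}"
      "c5 \<in> {c. H $ c $ v5 = 1}" "c5 \<in> {c. H $ c $ v6 = 1}"
      "c6 \<in> {c. H $ c $ v6 = 1}" "c6 \<in> {c. H $ c $ v1 = 1}"
    and chord: "c \<in> {c. H $ c $ v1 = 1}" "c \<in> {c. H $ c $ v4 = 1}"
    for v1 v2 v3 v4 v5 v6 c c1 c2 c3 c4 c5 c6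
  proof -
    let ?p = "[Inl v1, Inr c1, Inl v2, Inr c2, Inl v3, Inr c3, Inl v4, Inr c4, Inl v5, Inr c5,
      Inl v6, Inr c6]"
    have "is_cycle (tanner_graph H) ?p"
      using dist inc by (auto simp: is_cycle_iff less_Suc_eq)
    then have "chordless (tanner_graph H) ?p" using chordless by simp
    moreover have "Inr c \<notin> set ?p" "Inl v1 \<in> set ?p" "Inl v4 \<in> set ?p" "v1 \<noteq> v4"
      using dist by auto
    moreover have "{Inl v1, Inr c} \<in> tanner_graph H" "{Inl v4, Inr c} \<in> tanner_graph H"
      using chord by simp_all
    ultimately show False unfolding chordless_def by blast
  qed
qed

theorem theorem5:
  fixes H :: "bit ^ 'n ^ 'm"
  assumes "\<forall>v. vertex_degree (tanner_graph H) (Inl v) = 3"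
    and "girth (tanner_graph H) = 8"
    and "\<forall>p. is_cycle (tanner_graph H) p \<and> length p \<le> 12 \<longrightarrow> chordless (tanner_graph H) p"
  shows "min_distance (ldpc_code H) \<ge> 10"
  unfolding min_distance_def
proof (rule INF_greatest)
  fix x assume x: "x \<in> ldpc_code H - {0}"
  then have "H *v x = 0" by (simp add: ldpc_code_def)
  then interpret even_v_node_set "{i. x $ i \<noteq> 0}" "\<lambda>v. {c. H $ c $ v = 1}"
    by (rule even_v_node_set_support[OF assms])
  have "{i. x $ i \<noteq> 0} \<noteq> {}" using x by (auto simp: vec_eq_iff)
  then have "10 \<le> hamming_weight x" unfolding hamming_weight_def by (rule card_ge_10)
  then show "10 \<le> enat (hamming_weight x)" by (simp add: numeral_eq_enat)
qed

end
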